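(* Let $A\in\mathcal{PC}_n$. Then $\mathcal{E}(A)$ is PWL connected.
   Context: $\mathcal{PC}_n$ is the set of $n$-by-$n$ reciprocal matrices: entrywise positive real matrices $A=[a_{ij}]$ with $a_{ji}=1/a_{ij}$ for all $1\leq i,j\leq n$. $\mathcal{V}_n$ is the set of entrywise positive real $n$-vectors. A vector $w\in\mathcal{V}_n$ is efficient for $A\in\mathcal{PC}_n$ if for every $v\in\mathcal{V}_n$, the entrywise inequalities $\left|a_{ij}-\frac{v_i}{v_j}\right|\leq\left|a_{ij}-\frac{w_i}{w_j}\right|$ for all $i,j$ imply that $v$ is proportional to $w$. $\mathcal{E}(A)$ is the set of all efficient vectors for $A$. Let $S\subseteq\mathbb{R}_+^k$. Two points $x,y\in S$ are PWL (piecewise linearly) connected in $S$ if, for some $u_0,\ldots,u_s\in S$ with $u_0=x$ and $u_s=y$, we have $tu_i+(1-t)u_{i+1}\in S$ for all $i=0,\ldots,s-1$ and all $t\in(0,1)$. The set $S$ is PWL connected if any $x,y\in S$ are PWL connected in $S$. *)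

theory Defs
  imports "HOL-Analysis.Analysis"
begin

(* The order n is the cardinality of the index type 'n. *)

definition reciprocal_matrices :: "(real ^ 'n ^ 'n) set" where
  "reciprocal_matrices = {A. \<forall>i j. A $ i $ j > 0 \<and> A $ j $ i = 1 / A $ i $ j}"

definition positive_vectors :: "(real ^ 'n) set" where
  "positive_vectors = {w. \<forall>i. w $ i > 0}"

(* The proportionality constant c is automatically positive when v and w are positive vectors. *)
definition efficient :: "real ^ 'n ^ 'n \<Rightarrow> real ^ 'n \<Rightarrow> bool" where
  "efficient A w \<longleftrightarrow> w \<in> positive_vectors \<and>
     (\<forall>v\<in>positive_vectors.
        (\<forall>i j. \<bar>A $ i $ j - v $ i / v $ j\<bar> \<le> \<bar>A $ i $ j - w $ i / w $ j\<bar>)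
          \<longrightarrow> (\<exists>c. v = c *\<^sub>R w))"

definition efficient_vectors :: "real ^ 'n ^ 'n \<Rightarrow> (real ^ 'n) set" where
  "efficient_vectors A = {w. efficient A w}"

definition PWL_connected_in :: "'a::real_vector set \<Rightarrow> 'a \<Rightarrow> 'a \<Rightarrow> bool" where
  "PWL_connected_in S x y \<longleftrightarrow>
     (\<exists>(s::nat) (u::nat \<Rightarrow> 'a). (\<forall>i\<le>s. u i \<in> S) \<and> u 0 = x \<and> u s = y \<and>
        (\<forall>i<s. \<forall>t\<in>{0<..<1}. t *\<^sub>R u i + (1 - t) *\<^sub>R u (Suc i) \<in> S))"

definition PWL_connected :: "'a::real_vector set \<Rightarrow> bool" where
  "PWL_connected S \<longleftrightarrow> (\<forall>x\<in>S. \<forall>y\<in>S. PWL_connected_in S x y)"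

end

theory Submission
  imports Defs
begin

text \<open>
  Attach to a positive vector \<open>w\<close> the digraph with an edge from \<open>i\<close> to \<open>j\<close> whenever
  \<open>a\<^sub>i\<^sub>j w\<^sub>j \<le> w\<^sub>i\<close>, that is, whenever the ratio \<open>w\<^sub>i / w\<^sub>j\<close> is not below \<open>a\<^sub>i\<^sub>j\<close>.  The vector is
  efficient exactly when this digraph is strongly connected (\<open>efficient_iff_strongly_connected\<close>).
  Call a pair tight if \<open>w\<^sub>i = a\<^sub>i\<^sub>j w\<^sub>j\<close>; since \<open>A\<close> is reciprocal, a tight pair gives edges in both
  directions, so a vector whose tight pairs contain a spanning tree is efficient.

  Fix an index \<open>k\<close>.  Every efficient vector can be joined to a positive multiple of the \<open>k\<close>th
  column of \<open>A\<close>, which is the vector whose tight pairs contain the star centred at \<open>k\<close>.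

  \<^item> An efficient vector can be joined to one with a spanning tight tree
    (\<open>path_to_spanning_tight_tree\<close>).  Scale up the entries on a tight tree until the first edge
    that enters the tree becomes tight; until then no edge is lost, so strong connectivity persists,
    and at that moment the tree can be enlarged.

  \<^item> A vector with a spanning tight tree can be joined to the star
    (\<open>path_from_tight_tree_to_column\<close>).  Remove the leaves one at a time.  While the entry of a
    leaf \<open>i\<close> moves from the value that is tight for its neighbour \<open>j\<close> to the value that is tight
    for \<open>k\<close>, its digraph has one edge between \<open>i\<close> and \<open>{j, k}\<close> in each direction, and the
    remaining indices stay connected through tight pairs.

  Both kinds of moves are along straight segments, and so is the move between two multiples of the
  column.
\<close>

section \<open>Reciprocal matrices and the digraph of a vector\<close>

definition ratio_digraph :: "real ^ 'n ^ 'n \<Rightarrow> real ^ 'n \<Rightarrow> ('n \<times> 'n) set" where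
  "ratio_digraph A w = {(i, j). A $ i $ j * w $ j \<le> w $ i}"

lemma in_ratio_digraph_iff: "(i, j) \<in> ratio_digraph A w \<longleftrightarrow> A $ i $ j * w $ j \<le> w $ i"
  by (simp add: ratio_digraph_def)

lemma reciprocal_pos: "A \<in> reciprocal_matrices \<Longrightarrow> A $ i $ j > 0"
  unfolding reciprocal_matrices_def by blast

lemma reciprocal_inverse: "A \<in> reciprocal_matrices \<Longrightarrow> A $ j $ i = 1 / A $ i $ j"
  unfolding reciprocal_matrices_def by blast

lemma reciprocal_mult_le_iff:
  assumes "A \<in> reciprocal_matrices"
  shows "A $ j $ i * x \<le> y \<longleftrightarrow> x \<le> A $ i $ j * y"
proof -
  have "A $ i $ j > 0" by (rule reciprocal_pos[OF assms])
  then show ?thesis by (simp add: reciprocal_inverse[OF assms, of j i] field_simps)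
qed

lemma reciprocal_diagonal:
  assumes "A \<in> reciprocal_matrices"
  shows "A $ k $ k = 1"
proof -
  have "A $ k $ k > 0" by (rule reciprocal_pos[OF assms])
  moreover have "A $ k $ k * A $ k $ k = A $ k $ k * (1 / A $ k $ k)"
    by (rule arg_cong[OF reciprocal_inverse[OF assms]])
  ultimately have "(A $ k $ k)\<^sup>2 = 1" by (simp add: power2_eq_square)
  then show ?thesis using \<open>A $ k $ k > 0\<close> by (simp add: power2_eq_1_iff)
qed

lemma tight_pair_edges:
  assumes "A \<in> reciprocal_matrices" "w $ i = A $ i $ j * w $ j"
  shows "(i, j) \<in> ratio_digraph A w" "(j, i) \<in> ratio_digraph A w"
  using assms by (simp_all add: in_ratio_digraph_iff reciprocal_mult_le_iff)

section \<open>Efficiency is strong connectivity\<close>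

text \<open>
  If \<open>v\<close> has errors no larger than those of \<open>w\<close>, an edge from \<open>i\<close> to \<open>j\<close> forces
  \<open>v\<^sub>i / v\<^sub>j \<le> w\<^sub>i / w\<^sub>j\<close>; so \<open>v / w\<close> does not decrease along edges and is constant
  when they connect everything.
\<close>
lemma efficient_if_strongly_connected:
  fixes A :: "real ^ 'n ^ 'n"
  assumes w: "w \<in> positive_vectors"
    and conn: "\<And>i j. (i, j) \<in> (ratio_digraph A w)\<^sup>*"
  shows "efficient A w"
  unfolding efficient_def
proof (intro conjI w ballI impI)
  fix v assume v: "v \<in> positive_vectors"
    and err: "\<forall>i j. \<bar>A $ i $ j - v $ i / v $ j\<bar> \<le> \<bar>A $ i $ j - w $ i / w $ j\<bar>"
  have wp: "\<And>i. w $ i > 0" and vp: "\<And>i. v $ i > 0"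
    using w v by (auto simp: positive_vectors_def)
  have edge: "v $ i / w $ i \<le> v $ j / w $ j" if "(i, j) \<in> ratio_digraph A w" for i j
  proof -
    have "A $ i $ j \<le> w $ i / w $ j"
      using that wp[of j] by (simp add: in_ratio_digraph_iff field_simps)
    moreover have "\<bar>A $ i $ j - v $ i / v $ j\<bar> \<le> \<bar>A $ i $ j - w $ i / w $ j\<bar>"
      using err by blast
    ultimately have "v $ i / v $ j \<le> w $ i / w $ j" by linarith
    then show ?thesis using wp[of i] wp[of j] vp[of i] vp[of j] by (simp add: field_simps)
  qed
  have mono: "v $ i / w $ i \<le> v $ j / w $ j" for i j
    using conn[of i j] by (induction rule: rtrancl_induct) (auto dest: edge)
  obtain k :: 'n where True by simp
  define c where "c = v $ k / w $ k"
  have "v $ i / w $ i = c" for i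
    unfolding c_def by (rule antisym[OF mono mono])
  then have "v $ i = c * w $ i" for i
    using wp[of i] by (simp add: divide_eq_eq)
  then have "v = c *\<^sub>R w" by (simp add: vec_eq_iff)
  then show "\<exists>c. v = c *\<^sub>R w" ..
qed

definition scale_on :: "'n set \<Rightarrow> real \<Rightarrow> real ^ 'n \<Rightarrow> real ^ 'n" where
  "scale_on S c w = (\<chi> i. if i \<in> S then c * w $ i else w $ i)"

lemma scale_on_nth [simp]: "scale_on S c w $ i = (if i \<in> S then c * w $ i else w $ i)"
  by (simp add: scale_on_def)

lemma scale_on_positive:
  "w \<in> positive_vectors \<Longrightarrow> c > 0 \<Longrightarrow> scale_on S c w \<in> positive_vectors"
  by (simp add: positive_vectors_def)

text \<open>
  If no edge left \<open>U\<close>, then all ratios from \<open>U\<close> to its complement would be strictly too small, and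
  scaling the entries on \<open>U\<close> up slightly would reduce all errors across the cut and keep the others.
\<close>
lemma efficient_imp_edge_leaving:
  assumes A: "A \<in> reciprocal_matrices" and eff: "efficient A w"
    and U: "U \<noteq> {}" "U \<noteq> UNIV"
  obtains i j where "i \<in> U" "j \<notin> U" "(i, j) \<in> ratio_digraph A w"
proof (rule ccontr)
  assume "\<not> thesis"
  with that have no_edge_leaving: "i \<in> U \<Longrightarrow> j \<notin> U \<Longrightarrow> (i, j) \<notin> ratio_digraph A w" for i j
    by blast
  have no_edge: "w $ i < A $ i $ j * w $ j" if "i \<in> U" "j \<notin> U" for i j
    using no_edge_leaving[OF that] by (simp add: in_ratio_digraph_iff)
  have w: "w \<in> positive_vectors" using eff by (simp add: efficient_def)
  then have wp: "\<And>i. w $ i > 0" by (simp add: positive_vectors_def)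
  note Ap = reciprocal_pos[OF A]
  define C where "C = (\<lambda>(i, j). A $ i $ j * w $ j / w $ i) ` (U \<times> (- U))"
  have C: "finite C" "C \<noteq> {}" using U by (auto simp: C_def)
  \<comment> \<open>the largest factor that does not push any ratio across the cut beyond its target\<close>
  define c where "c = Min C"
  have "x > 1" if x_in: "x \<in> C" for x
  proof -
    obtain i j where "i \<in> U" "j \<notin> U" and x: "x = A $ i $ j * w $ j / w $ i"
      using x_in unfolding C_def by auto
    then show ?thesis using no_edge[of i j] wp[of i] by (simp add: less_divide_eq)
  qed
  then have c1: "c > 1" using C by (simp add: c_def)
  have c_le: "c * w $ i \<le> A $ i $ j * w $ j" if "i \<in> U" "j \<notin> U" for i j
  proof -
    have "A $ i $ j * w $ j / w $ i \<in> C"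
      unfolding C_def by (rule image_eqI[where x = "(i, j)"]) (use that in auto)
    then have "c \<le> A $ i $ j * w $ j / w $ i" using C by (simp add: c_def)
    then show ?thesis using wp[of i] by (simp add: le_divide_eq)
  qed
  define v where "v = scale_on U c w"
  have v: "v \<in> positive_vectors" using scale_on_positive[OF w] c1 by (simp add: v_def)
  have up: "\<bar>A $ i $ j - v $ i / v $ j\<bar> \<le> \<bar>A $ i $ j - w $ i / w $ j\<bar>"
    if "i \<in> U" "j \<notin> U" for i j
  proof -
    have "w $ i / w $ j \<le> v $ i / v $ j"
      using that c1 wp[of i] wp[of j] by (simp add: v_def divide_right_mono)
    moreover have "v $ i / v $ j \<le> A $ i $ j"
      using that c_le[OF that] wp[of j] by (simp add: v_def divide_le_eq)
    ultimately show ?thesis by linarith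
  qed
  have down: "\<bar>A $ i $ j - v $ i / v $ j\<bar> \<le> \<bar>A $ i $ j - w $ i / w $ j\<bar>"
    if "i \<notin> U" "j \<in> U" for i j
  proof -
    have "v $ i / v $ j \<le> w $ i / w $ j"
      using that c1 wp[of i] wp[of j] by (simp add: v_def divide_left_mono)
    moreover have "A $ i $ j \<le> v $ i / v $ j"
      using that c_le[OF that(2,1)] c1 wp[of j] reciprocal_mult_le_iff[OF A, of i j]
      by (simp add: v_def le_divide_eq)
    ultimately show ?thesis by linarith
  qed
  have "\<bar>A $ i $ j - v $ i / v $ j\<bar> \<le> \<bar>A $ i $ j - w $ i / w $ j\<bar>" for i j
    using up[of i j] down[of i j] c1 by (cases "i \<in> U"; cases "j \<in> U") (auto simp: v_def)
  then obtain d where d: "v = d *\<^sub>R w" using eff v unfolding efficient_def by blast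
  obtain i j where "i \<in> U" "j \<notin> U" using U by auto
  moreover have "v $ i = d * w $ i" "v $ j = d * w $ j" by (simp_all add: d)
  ultimately have "c = d" "d = 1" using wp[of i] wp[of j] by (simp_all add: v_def)
  then show False using c1 by simp
qed

lemma efficient_iff_strongly_connected:
  assumes "A \<in> reciprocal_matrices"
  shows "efficient A w \<longleftrightarrow>
    w \<in> positive_vectors \<and> (\<forall>i j. (i, j) \<in> (ratio_digraph A w)\<^sup>*)"
proof (intro iffI conjI allI)
  fix i j assume eff: "efficient A w"
  show "(i, j) \<in> (ratio_digraph A w)\<^sup>*"
  proof (rule ccontr)
    assume no: "(i, j) \<notin> (ratio_digraph A w)\<^sup>*"
    define U where "U = (ratio_digraph A w)\<^sup>* `` {i}"
    have "i \<in> U" "j \<notin> U" using no by (auto simp: U_def)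
    then have "U \<noteq> {}" "U \<noteq> UNIV" by auto
    then obtain a b where "a \<in> U" "b \<notin> U" "(a, b) \<in> ratio_digraph A w"
      by (rule efficient_imp_edge_leaving[OF assms eff])
    then show False unfolding U_def by (blast intro: rtrancl_into_rtrancl)
  qed
next
  show "w \<in> positive_vectors" if "efficient A w"
    using that by (simp add: efficient_def)
next
  show "efficient A w"
    if "w \<in> positive_vectors \<and> (\<forall>i j. (i, j) \<in> (ratio_digraph A w)\<^sup>*)"
    using that by (simp add: efficient_if_strongly_connected)
qed

lemma efficient_if_hub:
  assumes "w \<in> positive_vectors"
    and "\<And>i. (i, k) \<in> (ratio_digraph A w)\<^sup>*" "\<And>i. (k, i) \<in> (ratio_digraph A w)\<^sup>*"
  shows "efficient A w"
  using rtrancl_trans[OF assms(2,3)]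
  by (intro efficient_if_strongly_connected[OF assms(1)])

section \<open>Trees of tight pairs\<close>

text \<open>The vertex sets of trees of tight pairs, grown from the root \<open>k\<close> by attaching leaves.\<close>
inductive tight_tree :: "real ^ 'n ^ 'n \<Rightarrow> real ^ 'n \<Rightarrow> 'n \<Rightarrow> 'n set \<Rightarrow> bool"
  for A w k where
  root: "tight_tree A w k {k}"
| leaf: "tight_tree A w k S \<Longrightarrow> j \<in> S \<Longrightarrow> i \<notin> S \<Longrightarrow> w $ i = A $ i $ j * w $ j
    \<Longrightarrow> tight_tree A w k (insert i S)"

lemma root_in_tight_tree: "tight_tree A w k S \<Longrightarrow> k \<in> S"
  by (induction rule: tight_tree.induct) auto

lemma tight_tree_scale:
  assumes "tight_tree A w k S" "\<And>i. i \<in> S \<Longrightarrow> v $ i = c * w $ i"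
  shows "tight_tree A v k S"
  using assms
proof (induction rule: tight_tree.induct)
  case root
  show ?case by (rule tight_tree.root)
next
  case (leaf S j i)
  have "v $ i = A $ i $ j * v $ j"
    using leaf.hyps(2,4) leaf.prems[of i] leaf.prems[of j] by simp
  moreover have "tight_tree A v k S"
    using leaf.prems by (intro leaf.IH) simp
  ultimately show ?case using leaf.hyps(2,3) by (intro tight_tree.leaf)
qed

lemma tight_tree_strongly_connected:
  assumes A: "A \<in> reciprocal_matrices" and "tight_tree A w k S" "x \<in> S"
  shows "(x, k) \<in> (ratio_digraph A w)\<^sup>* \<and> (k, x) \<in> (ratio_digraph A w)\<^sup>*"
  using assms(2,3)
proof (induction arbitrary: x rule: tight_tree.induct)
  case (leaf S j i)
  have j: "(j, k) \<in> (ratio_digraph A w)\<^sup>*" "(k, j) \<in> (ratio_digraph A w)\<^sup>*"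
    using leaf.IH[OF leaf.hyps(2)] by blast+
  have "(i, k) \<in> (ratio_digraph A w)\<^sup>*"
    by (rule converse_rtrancl_into_rtrancl[OF tight_pair_edges(1)[OF A leaf.hyps(4)] j(1)])
  moreover have "(k, i) \<in> (ratio_digraph A w)\<^sup>*"
    by (rule rtrancl_into_rtrancl[OF j(2) tight_pair_edges(2)[OF A leaf.hyps(4)]])
  ultimately show ?case using leaf.IH[of x] leaf.prems by blast
qed simp

section \<open>Piecewise linear paths\<close>

text \<open>
  Paths as a reflexive transitive closure make concatenation and reversal immediate, with no
  reindexing of vertices.
\<close>
definition segment_path :: "'a::real_vector set \<Rightarrow> 'a \<Rightarrow> 'a \<Rightarrow> bool" where
  "segment_path S = (\<lambda>x y. closed_segment x y \<subseteq> S)\<^sup>*\<^sup>*"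

lemma segment_path_segment: "closed_segment x y \<subseteq> S \<Longrightarrow> segment_path S x y"
  by (simp add: segment_path_def r_into_rtranclp)

lemma segment_path_trans: "segment_path S x y \<Longrightarrow> segment_path S y z \<Longrightarrow> segment_path S x z"
  by (simp add: segment_path_def)

lemma segment_path_sym:
  assumes "segment_path S x y"
  shows "segment_path S y x"
proof -
  have "symp (\<lambda>x y. closed_segment x y \<subseteq> S)"
    by (rule sympI) (simp add: closed_segment_commute)
  from sympD[OF symp_rtranclp[OF this]] show ?thesis
    using assms unfolding segment_path_def .
qed

lemma segment_path_imp_PWL_connected_in:
  assumes "segment_path S x y" "x \<in> S"
  shows "PWL_connected_in S x y"
  using assms(1) unfolding segment_path_def
proof (induction rule: rtranclp_induct)
  case base
  show ?case using assms(2) unfolding PWL_connected_in_def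
    by (intro exI[of _ 0] exI[of _ "\<lambda>_. x"]) auto
next
  case (step y z)
  then obtain s u where u: "\<forall>i\<le>s. u i \<in> S" "u 0 = x" "u s = y"
    "\<forall>i<s. \<forall>t\<in>{0<..<1}. t *\<^sub>R u i + (1 - t) *\<^sub>R u (Suc i) \<in> S"
    unfolding PWL_connected_in_def by blast
  have seg: "t *\<^sub>R y + (1 - t) *\<^sub>R z \<in> S" if "t \<in> {0<..<1}" for t
  proof -
    have "t *\<^sub>R y + (1 - t) *\<^sub>R z \<in> closed_segment y z"
      unfolding in_segment using that by (intro exI[of _ "1 - t"]) auto
    then show ?thesis using step.hyps by blast
  qed
  have "z \<in> S" using step.hyps(2) by auto
  then show ?case unfolding PWL_connected_in_def
    using u seg by (intro exI[of _ "Suc s"] exI[of _ "u(Suc s := z)"])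
      (auto simp: less_Suc_eq le_Suc_eq)
qed

section \<open>From an efficient vector to a spanning tight tree\<close>

text \<open>
  Scaling \<open>S\<close> up by a factor at least \<open>1\<close> keeps the edges inside \<open>S\<close>, outside \<open>S\<close> and leaving \<open>S\<close>.
  The edges entering \<open>S\<close> survive as long as the factor is at most the bound \<open>c\<close>.
\<close>
lemma scale_on_segment_efficient:
  assumes A: "A \<in> reciprocal_matrices" and eff: "efficient A w" and c: "1 \<le> c"
    and bound: "\<And>i j. i \<notin> S \<Longrightarrow> j \<in> S \<Longrightarrow> (i, j) \<in> ratio_digraph A w \<Longrightarrow>
      c * (A $ i $ j * w $ j) \<le> w $ i"
  shows "closed_segment w (scale_on S c w) \<subseteq> efficient_vectors A"
proof
  fix z assume "z \<in> closed_segment w (scale_on S c w)"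
  then obtain u where u: "0 \<le> u" "u \<le> 1" and z: "z = (1 - u) *\<^sub>R w + u *\<^sub>R scale_on S c w"
    by (auto simp: in_segment)
  define s where "s = 1 + u * (c - 1)"
  have s: "1 \<le> s" "s \<le> c"
    using u c mult_right_mono[of u 1 "c - 1"] by (auto simp: s_def)
  have zs: "z = scale_on S s w"
    by (simp add: z s_def vec_eq_iff algebra_simps)
  have w: "w \<in> positive_vectors" and conn: "\<And>i j. (i, j) \<in> (ratio_digraph A w)\<^sup>*"
    using eff efficient_iff_strongly_connected[OF A] by auto
  have wp: "\<And>i. w $ i > 0" using w by (simp add: positive_vectors_def)
  note Ap = reciprocal_pos[OF A]
  have "(i, j) \<in> ratio_digraph A z" if e: "(i, j) \<in> ratio_digraph A w" for i j
  proof -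
    have le: "A $ i $ j * w $ j \<le> w $ i" using e by (simp add: in_ratio_digraph_iff)
    consider "i \<in> S" "j \<in> S" | "i \<notin> S" "j \<notin> S" | "i \<in> S" "j \<notin> S" | "i \<notin> S" "j \<in> S"
      by blast
    then show ?thesis
    proof cases
      case 1
      then show ?thesis
        using mult_left_mono[OF le, of s] s by (simp add: zs in_ratio_digraph_iff algebra_simps)
    next
      case 2
      then show ?thesis using le by (simp add: zs in_ratio_digraph_iff)
    next
      case 3
      have "w $ i \<le> s * w $ i" using s wp[of i] by simp
      then show ?thesis using 3 le by (simp add: zs in_ratio_digraph_iff)
    next
      case 4
      have "s * (A $ i $ j * w $ j) \<le> c * (A $ i $ j * w $ j)"
        using s wp[of j] Ap[of i j] by (intro mult_right_mono) auto
      then show ?thesis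
        using 4 bound[OF 4 e] by (simp add: zs in_ratio_digraph_iff algebra_simps)
    qed
  qed
  then have "ratio_digraph A w \<subseteq> ratio_digraph A z" by auto
  then have "(ratio_digraph A w)\<^sup>* \<subseteq> (ratio_digraph A z)\<^sup>*" by (rule rtrancl_mono)
  then have "efficient A z"
    using conn scale_on_positive[OF w] s
    by (intro efficient_if_strongly_connected) (auto simp: zs)
  then show "z \<in> efficient_vectors A" by (simp add: efficient_vectors_def)
qed

text \<open>
  The scaling factor is the smallest ratio \<open>w\<^sub>i / (a\<^sub>i\<^sub>j w\<^sub>j)\<close> over the edges that enter \<open>S\<close>: the
  edge attaining it becomes tight and no other entering edge has been lost.
\<close>
lemma extend_tight_tree:
  assumes A: "A \<in> reciprocal_matrices" and eff: "efficient A w"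
    and tree: "tight_tree A w k S" and S: "S \<noteq> UNIV"
  obtains v i where "efficient A v" "segment_path (efficient_vectors A) w v"
    "i \<notin> S" "tight_tree A v k (insert i S)"
proof -
  have wp: "\<And>i. w $ i > 0" using eff by (simp add: efficient_def positive_vectors_def)
  note Ap = reciprocal_pos[OF A]
  define E where "E = ratio_digraph A w \<inter> (- S) \<times> S"
  define f where "f = (\<lambda>(i, j). w $ i / (A $ i $ j * w $ j))"
  have "k \<in> S" by (rule root_in_tight_tree[OF tree])
  \<comment> \<open>strong connectivity provides an edge entering \<open>S\<close>, hence a bound on the scaling\<close>
  then have "- S \<noteq> {}" "- S \<noteq> UNIV" using S by auto
  then obtain a b where "a \<in> - S" "b \<notin> - S" "(a, b) \<in> ratio_digraph A w"
    by (rule efficient_imp_edge_leaving[OF A eff])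
  then have "E \<noteq> {}" by (auto simp: E_def)
  moreover have fin: "finite E" by simp
  ultimately obtain i j where ij: "(i, j) \<in> E" and c: "f (i, j) = Min (f ` E)"
    using Min_in[of "f ` E"] by (metis (no_types, lifting) finite_imageI image_iff image_is_empty surj_pair)
  define c where "c = f (i, j)"
  have c_eq: "c = w $ i / (A $ i $ j * w $ j)" by (simp add: c_def f_def)
  have ijS: "i \<notin> S" "j \<in> S" and le: "A $ i $ j * w $ j \<le> w $ i"
    using ij by (auto simp: E_def in_ratio_digraph_iff)
  have c1: "1 \<le> c" using le wp[of j] Ap[of i j] by (simp add: c_eq)
  have bound: "c * (A $ x $ y * w $ y) \<le> w $ x"
    if "x \<notin> S" "y \<in> S" "(x, y) \<in> ratio_digraph A w" for x y
  proof -
    have "(x, y) \<in> E" using that by (simp add: E_def)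
    then have "c \<le> f (x, y)" using fin by (simp add: c_def c)
    then show ?thesis using wp[of y] Ap[of x y] by (simp add: f_def field_simps)
  qed
  define v where "v = scale_on S c w"
  have seg: "closed_segment w v \<subseteq> efficient_vectors A"
    unfolding v_def by (rule scale_on_segment_efficient[OF A eff c1 bound])
  have "tight_tree A v k S"
    by (rule tight_tree_scale[OF tree, of _ c]) (simp add: v_def)
  moreover have "v $ i = A $ i $ j * v $ j"
    using ijS wp[of j] Ap[of i j] by (simp add: v_def c_eq)
  ultimately have "tight_tree A v k (insert i S)"
    using ijS by (intro tight_tree.leaf)
  moreover have "efficient A v" using seg by (auto simp: efficient_vectors_def)
  ultimately show thesis
    using that ijS segment_path_segment[OF seg] by blast
qed

lemma path_to_spanning_tight_tree:
  assumes A: "A \<in> reciprocal_matrices" and "efficient A w"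
  obtains v where "efficient A v" "segment_path (efficient_vectors A) w v" "tight_tree A v k UNIV"
proof -
  have "\<exists>v. efficient A v \<and> segment_path (efficient_vectors A) w v \<and> tight_tree A v k UNIV"
    if "efficient A w" "tight_tree A w k S" for w S
    using that
  proof (induction "card (- S)" arbitrary: w S rule: less_induct)
    case less
    show ?case
    proof (cases "S = UNIV")
      case True
      then show ?thesis using less.prems by (auto simp: segment_path_def)
    next
      case False
      then obtain v i where v: "efficient A v" "segment_path (efficient_vectors A) w v"
        "i \<notin> S" "tight_tree A v k (insert i S)"
        using extend_tight_tree[OF A less.prems] by metis
      have "card (- insert i S) < card (- S)"
        using v(3) by (intro psubset_card_mono) auto
      from less.hyps[OF this v(1,4)] show ?thesis
        using segment_path_trans[OF v(2)] by blast
    qed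
  qed
  from this[OF assms(2) tight_tree.root] show thesis using that by blast
qed

section \<open>From a spanning tight tree to a column of the matrix\<close>

text \<open>
  The last leaf \<open>i\<close> of the tree is the only index that moves, so the rest of the tree, and the
  indices already attached to \<open>k\<close>, stay connected through tight pairs.  On the segment, the entry at
  \<open>i\<close> lies between the two values that make \<open>i\<close> tight with \<open>j\<close> and with \<open>k\<close>; so one of \<open>j\<close>, \<open>k\<close>
  has an edge to \<open>i\<close> and the other an edge from \<open>i\<close>.
\<close>
lemma move_leaf_segment_efficient:
  assumes A: "A \<in> reciprocal_matrices" and w: "w \<in> positive_vectors"
    and tree: "tight_tree A w k S" and j: "j \<in> S" and i: "i \<notin> S"
    and tight: "w $ i = A $ i $ j * w $ j"
    and rest: "\<And>m. m \<notin> insert i S \<Longrightarrow> w $ m = A $ m $ k * w $ k"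
    and v: "v $ i = A $ i $ k * w $ k" "\<And>m. m \<noteq> i \<Longrightarrow> v $ m = w $ m"
  shows "closed_segment w v \<subseteq> efficient_vectors A"
proof
  fix z assume "z \<in> closed_segment w v"
  then obtain u where u: "0 \<le> u" "u \<le> 1" and z: "z = (1 - u) *\<^sub>R w + u *\<^sub>R v"
    by (auto simp: in_segment)
  have z_other: "z $ m = w $ m" if "m \<noteq> i" for m
    using v(2)[OF that] by (simp add: z algebra_simps)
  have k: "k \<in> S" by (rule root_in_tight_tree[OF tree])
  have ne: "j \<noteq> i" "k \<noteq> i" using i j k by auto
  have "z $ i \<in> closed_segment (w $ i) (v $ i)"
    using u by (auto simp: z in_segment)
  then have between: "A $ i $ j * z $ j \<le> z $ i \<and> z $ i \<le> A $ i $ k * z $ k \<or>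
      A $ i $ k * z $ k \<le> z $ i \<and> z $ i \<le> A $ i $ j * z $ j"
    using ne by (auto simp: closed_segment_eq_real_ivl tight v(1) z_other split: if_splits)
  have wp: "\<And>m. w $ m > 0" using w by (simp add: positive_vectors_def)
  have "0 < A $ i $ j * z $ j" "0 < A $ i $ k * z $ k"
    using wp ne reciprocal_pos[OF A] by (simp_all add: z_other)
  then have "z $ i > 0" using between by linarith
  then have "z $ m > 0" for m
    using wp z_other by (cases "m = i") auto
  then have zpos: "z \<in> positive_vectors" by (simp add: positive_vectors_def)
  have treez: "tight_tree A z k S"
    using i by (intro tight_tree_scale[OF tree, of _ 1]) (auto intro: z_other)
  let ?D = "ratio_digraph A z"
  have jk: "(j, k) \<in> ?D\<^sup>*" "(k, j) \<in> ?D\<^sup>*"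
    using tight_tree_strongly_connected[OF A treez j] by auto
  have "((i, j) \<in> ?D \<and> (k, i) \<in> ?D) \<or> ((i, k) \<in> ?D \<and> (j, i) \<in> ?D)"
    using between by (simp add: in_ratio_digraph_iff reciprocal_mult_le_iff[OF A])
  then have ik: "(i, k) \<in> ?D\<^sup>*" "(k, i) \<in> ?D\<^sup>*"
    using jk by (meson converse_rtrancl_into_rtrancl rtrancl_into_rtrancl r_into_rtrancl)+
  have "(m, k) \<in> ?D\<^sup>* \<and> (k, m) \<in> ?D\<^sup>*" for m
  proof -
    consider "m \<in> S" | "m = i" | "m \<notin> insert i S" by blast
    then show ?thesis
    proof cases
      case 1
      then show ?thesis using tight_tree_strongly_connected[OF A treez] by blast
    next
      case 2
      then show ?thesis using ik by simp
    next
      case 3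
      then have "z $ m = A $ m $ k * z $ k" using rest[OF 3] ne by (simp add: z_other)
      from tight_pair_edges[OF A this] show ?thesis by blast
    qed
  qed
  then have "efficient A z" using efficient_if_hub[OF zpos] by blast
  then show "z \<in> efficient_vectors A" by (simp add: efficient_vectors_def)
qed

text \<open>
  The vector changes from one leaf to the next, but on the remaining tree it stays equal to the vector
  \<open>w\<close> that defines the tree.  Hence the claim is proved for all positive vectors \<open>v\<close> that agree
  with \<open>w\<close> on the tree and for which the indices outside are already tight with \<open>k\<close>.
\<close>
lemma path_from_tight_tree_to_column:
  assumes A: "A \<in> reciprocal_matrices" and "tight_tree A w k S"
    and "v \<in> positive_vectors" "\<And>m. m \<in> S \<Longrightarrow> v $ m = w $ m"
    and "\<And>m. m \<notin> S \<Longrightarrow> v $ m = A $ m $ k * v $ k"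
  shows "segment_path (efficient_vectors A) v (w $ k *\<^sub>R column k A)"
  using assms(2-)
proof (induction arbitrary: v rule: tight_tree.induct)
  case root
  have k: "v $ k = w $ k" by (rule root.prems(2)) simp
  have "v $ m = A $ m $ k * w $ k" for m
  proof (cases "m = k")
    case True
    then show ?thesis using k by (simp add: reciprocal_diagonal[OF A])
  next
    case False
    then show ?thesis using root.prems(3)[of m] unfolding k by simp
  qed
  then have "v = w $ k *\<^sub>R column k A" by (simp add: vec_eq_iff column_def)
  then show ?case by (simp add: segment_path_def)
next
  case (leaf S j i)
  have k: "k \<in> S" by (rule root_in_tight_tree[OF leaf.hyps(1)])
  have agree: "v $ m = w $ m" if "m \<in> insert i S" for m
    using leaf.prems(2)[OF that] .
  define v' where "v' = (\<chi> m. if m = i then A $ i $ k * v $ k else v $ m)"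
  have treev: "tight_tree A v k S"
    by (rule tight_tree_scale[OF leaf.hyps(1), of _ 1]) (simp add: agree)
  have "closed_segment v v' \<subseteq> efficient_vectors A"
  proof (rule move_leaf_segment_efficient[OF A leaf.prems(1) treev leaf.hyps(2,3)])
    show "v $ i = A $ i $ j * v $ j" using leaf.hyps(2,4) by (simp add: agree)
    show "v $ m = A $ m $ k * v $ k" if "m \<notin> insert i S" for m
      by (rule leaf.prems(3)[OF that])
    show "v' $ i = A $ i $ k * v $ k" by (simp add: v'_def)
    show "v' $ m = v $ m" if "m \<noteq> i" for m
      using that by (simp add: v'_def)
  qed
  moreover have "segment_path (efficient_vectors A) v' (w $ k *\<^sub>R column k A)"
  proof (rule leaf.IH)
    show "v' \<in> positive_vectors"
      using leaf.prems(1) reciprocal_pos[OF A] by (simp add: positive_vectors_def v'_def)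
    show "v' $ m = w $ m" if "m \<in> S" for m
    proof -
      have "m \<noteq> i" using that leaf.hyps(3) by blast
      then show ?thesis using that by (simp add: v'_def agree)
    qed
    show "v' $ m = A $ m $ k * v' $ k" if "m \<notin> S" for m
    proof -
      have "v' $ k = v $ k" using k leaf.hyps(3) by (auto simp: v'_def)
      moreover have "v' $ m = A $ m $ k * v $ k"
      proof (cases "m = i")
        case False
        then show ?thesis using that by (simp add: v'_def leaf.prems(3)[of m])
      qed (simp add: v'_def)
      ultimately show ?thesis by simp
    qed
  qed
  ultimately show ?case by (rule segment_path_trans[OF segment_path_segment])
qed

lemma column_multiple_efficient:
  assumes A: "A \<in> reciprocal_matrices" and c: "c > 0"
  shows "efficient A (c *\<^sub>R column k A)"
proof (rule efficient_if_hub)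
  show "c *\<^sub>R column k A \<in> positive_vectors"
    using c reciprocal_pos[OF A] by (simp add: positive_vectors_def column_def)
  have "(c *\<^sub>R column k A) $ i = A $ i $ k * (c *\<^sub>R column k A) $ k" for i
    by (simp add: column_def reciprocal_diagonal[OF A])
  from tight_pair_edges[OF A this]
  show "(i, k) \<in> (ratio_digraph A (c *\<^sub>R column k A))\<^sup>*"
    "(k, i) \<in> (ratio_digraph A (c *\<^sub>R column k A))\<^sup>*" for i by blast+
qed

section \<open>Piecewise linear connectedness of the efficient vectors\<close>

theorem theorem20:
  fixes A :: "real ^ 'n ^ 'n"
  assumes "A \<in> reciprocal_matrices"
  shows "PWL_connected (efficient_vectors A)"
proof -
  let ?E = "efficient_vectors A"
  obtain k :: 'n where True by simp
  have to_column: "\<exists>c>0. segment_path ?E w (c *\<^sub>R column k A)" if "w \<in> ?E" for w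
  proof -
    have "efficient A w" using that by (simp add: efficient_vectors_def)
    then obtain v where v: "efficient A v" "segment_path ?E w v" "tight_tree A v k UNIV"
      by (rule path_to_spanning_tight_tree[OF assms])
    have pos: "v \<in> positive_vectors" using v(1) by (simp add: efficient_def)
    have "segment_path ?E v (v $ k *\<^sub>R column k A)"
      by (rule path_from_tight_tree_to_column[OF assms v(3) pos]) auto
    moreover have "v $ k > 0" using pos by (simp add: positive_vectors_def)
    ultimately show ?thesis using segment_path_trans[OF v(2)] by blast
  qed
  have columns: "segment_path ?E (c *\<^sub>R column k A) (d *\<^sub>R column k A)"
    if "c > 0" "d > 0" for c d
  proof (rule segment_path_segment, rule subsetI)
    fix z assume "z \<in> closed_segment (c *\<^sub>R column k A) (d *\<^sub>R column k A)"
    then obtain u where u: "0 \<le> u" "u \<le> 1"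
      and z: "z = (1 - u) *\<^sub>R c *\<^sub>R column k A + u *\<^sub>R d *\<^sub>R column k A"
      by (auto simp: in_segment)
    have "(1 - u) * c + u * d > 0"
      using u that by (cases "u = 0") (auto intro: add_nonneg_pos)
    then have "efficient A (((1 - u) * c + u * d) *\<^sub>R column k A)"
      by (rule column_multiple_efficient[OF assms])
    then show "z \<in> ?E" by (simp add: z efficient_vectors_def scaleR_add_left)
  qed
  show ?thesis unfolding PWL_connected_def
  proof (intro ballI)
    fix x y assume "x \<in> ?E" and "y \<in> ?E"
    obtain c where c: "c > 0" "segment_path ?E x (c *\<^sub>R column k A)"
      using to_column[OF \<open>x \<in> ?E\<close>] by blast
    obtain d where d: "d > 0" "segment_path ?E y (d *\<^sub>R column k A)"
      using to_column[OF \<open>y \<in> ?E\<close>] by blast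
    have "segment_path ?E x (d *\<^sub>R column k A)"
      by (rule segment_path_trans[OF c(2) columns[OF c(1) d(1)]])
    then have "segment_path ?E x y"
      by (rule segment_path_trans[OF _ segment_path_sym[OF d(2)]])
    then show "PWL_connected_in ?E x y"
      using \<open>x \<in> ?E\<close> by (rule segment_path_imp_PWL_connected_in)
  qed
qed

end
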